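(* Let $f$ and $h$ be slice monogenic $\mathbb{R}_n$-valued functions with $f_I=\sum_{A\in\mathcal{I}}F_AI_A$ and $h_I=\sum_{A\in\mathcal{I}}H_AI_A$ on a fixed slice $\mathbb{C}_I$, $I=I_1$. Then the equation $f*h=1$ is equivalent to the matrix equation $$M_f\cdot M_h=\mathrm{Id}_{2^{n-1}},$$ where $M_f$ is the $2^{n-1}\times2^{n-1}$ matrix indexed by $\mathcal{I}\times\mathcal{I}$ with entries $$(M_f)_{A,B}=(-1)^{\sigma(A\triangle B,B)}\begin{cases}F_{A\triangle B},&|A|\text{ even},\\ \hat F_{A\triangle B},&|A|\text{ odd},\end{cases}$$ and $M_h$ is defined by the same formula with $F_A$ replaced by $H_A$.
   Context: $\mathbb{R}_n$ ($n\ge2$) is the real unital associative algebra generated by $I_1,\dots,I_n$ with $I_iI_j+I_jI_i=-2\delta_{ij}$; $\mathcal{I}$ is the set of subsets of $\{2,\dots,n\}$; for $A=\{a_1<\dots<a_k\}\in\mathcal{I}$, $I_A=I_{a_1}\cdots I_{a_k}$, $I_\emptyset=1$. $(x_0,\dots,x_n)\in\mathbb{R}^{n+1}$ is identified with $x_0+x_1I_1+\dots+x_nI_n$; $\mathbb{S}$ is the set of unit 1-vectors; $\mathbb{C}_I=\mathbb{R}+I\mathbb{R}$ for $I\in\mathbb{S}$. Functions are defined on an axially symmetric slice domain $U\subseteq\mathbb{R}^{n+1}$ (a domain meeting $\mathbb{R}$, with each $U\cap\mathbb{C}_I$ a domain, and such that $u+Iv\in U$ implies $u+Jv\in U$ for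 all $J\in\mathbb{S}$). A real-differentiable $f:U\to\mathbb{R}_n$ is slice monogenic if for all $I\in\mathbb{S}$, $f_I=f|_{U\cap\mathbb{C}_I}$ satisfies $\frac12(\partial_u+I\partial_v)f_I(u+Iv)=0$. Then $f_I=\sum_{A\in\mathcal{I}}F_AI_A$ with unique holomorphic $F_A:U\cap\mathbb{C}_I\to\mathbb{C}_I$. $\hat F(z)=\overline{F(\bar z)}$; $A\triangle B$ is the symmetric difference; $\sigma(A,B)=|A\cap B|+|\{(a,b)\in A\times B:a>b\}|$. Slice product: $f_I*h_I=\sum_{C\in\mathcal{I}}K_CI_C$ with $K_C=\sum_{A\triangle B=C}(-1)^{\sigma(A,B)}F_A\widetilde H_B$, where $\widetilde H_B=H_B$ if $|A|$ is even and $\widetilde H_B=\hat H_B$ if $|A|$ is odd; $f*h$ is the unique slice monogenic extension of $f_I*h_I$ to $U$. *)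

theory Defs
  imports "HOL-Analysis.Analysis"
begin

section \<open>The Clifford algebra\<close>

text \<open>
  The generators are indexed by a finite linearly ordered type \<open>'n\<close>, standing for
  \<open>{1 < \<dots> < n}\<close> with \<open>n = CARD('n)\<close>. The algebra is realised on coefficient vectors
  indexed by subsets of \<open>'n\<close>. A fresh type is needed because \<open>real ^ 'n set\<close> already
  carries the componentwise product.
\<close>

definition csigma :: "'a::linorder set \<Rightarrow> 'a set \<Rightarrow> nat" where
  "csigma A B = card (A \<inter> B) + card {(a, b) \<in> A \<times> B. a > b}"

typedef (overloaded) 'n clifford = "UNIV :: (real ^ ('n::{finite,linorder}) set) set"
  morphisms coeffs Clifford by simp

setup_lifting type_definition_clifford

instantiation clifford :: ("{finite,linorder}") real_vector
begin
lift_definition zero_clifford :: "'a clifford" is 0 .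
lift_definition plus_clifford :: "'a clifford \<Rightarrow> 'a clifford \<Rightarrow> 'a clifford" is "(+)" .
lift_definition minus_clifford :: "'a clifford \<Rightarrow> 'a clifford \<Rightarrow> 'a clifford" is "(-)" .
lift_definition uminus_clifford :: "'a clifford \<Rightarrow> 'a clifford" is "uminus" .
lift_definition scaleR_clifford :: "real \<Rightarrow> 'a clifford \<Rightarrow> 'a clifford" is "(*\<^sub>R)" .
instance
  by standard (transfer; simp add: algebra_simps)+
end

instantiation clifford :: ("{finite,linorder}") euclidean_space
begin
lift_definition inner_clifford :: "'a clifford \<Rightarrow> 'a clifford \<Rightarrow> real" is "(\<bullet>)" .
lift_definition norm_clifford :: "'a clifford \<Rightarrow> real" is norm .
definition sgn_clifford :: "'a clifford \<Rightarrow> 'a clifford" where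
  "sgn_clifford x = x /\<^sub>R norm x"
definition dist_clifford :: "'a clifford \<Rightarrow> 'a clifford \<Rightarrow> real" where
  "dist_clifford x y = norm (x - y)"
definition uniformity_clifford :: "('a clifford \<times> 'a clifford) filter" where
  "uniformity_clifford = (INF e\<in>{0<..}. principal {(x, y). dist x y < e})"
definition open_clifford :: "'a clifford set \<Rightarrow> bool" where
  "open_clifford U = (\<forall>x\<in>U. eventually (\<lambda>(x', y). x' = x \<longrightarrow> y \<in> U) uniformity)"
lift_definition Basis_clifford :: "'a clifford set" is Basis .
instance
proof
  fix x y z :: "'a clifford" and r :: real and U :: "'a clifford set"
  show "dist x y = norm (x - y)" by (rule dist_clifford_def)
  show "sgn x = x /\<^sub>R norm x" by (rule sgn_clifford_def)
  show "uniformity = (INF e\<in>{0<..}. principal {(x :: 'a clifford, y). dist x y < e})"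
    by (rule uniformity_clifford_def)
  show "open U = (\<forall>x\<in>U. eventually (\<lambda>(x', y). x' = x \<longrightarrow> y \<in> U) uniformity)"
    by (rule open_clifford_def)
  show "inner x y = inner y x" by transfer (rule inner_commute)
  show "inner (x + y) z = inner x z + inner y z" by transfer (rule inner_add_left)
  show "inner (r *\<^sub>R x) y = r * inner x y" by transfer simp
  show "0 \<le> inner x x" by transfer simp
  show "inner x x = 0 \<longleftrightarrow> x = 0" by transfer simp
  show "norm x = sqrt (inner x x)" by transfer (rule norm_eq_sqrt_inner)
  show "(Basis :: 'a clifford set) \<noteq> {}" by transfer simp
  show "finite (Basis :: 'a clifford set)" by transfer simp
  show "x \<in> Basis \<Longrightarrow> y \<in> Basis \<Longrightarrow> inner x y = (if x = y then 1 else 0)"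
    by transfer (rule inner_Basis)
  show "(\<forall>u\<in>Basis. inner x u = 0) \<longleftrightarrow> x = 0" by transfer (rule euclidean_all_zero_iff)
qed
end

abbreviation ccoeff :: "'n::{finite,linorder} clifford \<Rightarrow> 'n set \<Rightarrow> real" where
  "ccoeff x A \<equiv> coeffs x $ A"

lemma sign_sigma:
  fixes A B :: "'a::{finite,linorder} set"
  shows "(-1::real) ^ csigma A B = (\<Prod>a\<in>A. \<Prod>b\<in>B. if a \<ge> b then -1 else 1)"
proof -
  let ?S = "{(a, b) \<in> A \<times> B. a > b}" and ?T = "(\<lambda>a. (a, a)) ` (A \<inter> B)"
  have "(\<Prod>a\<in>A. \<Prod>b\<in>B. if a \<ge> b then -1 else 1 :: real)
      = (\<Prod>p\<in>A \<times> B. if snd p \<le> fst p then -1 else 1)"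
    by (simp add: prod.cartesian_product case_prod_beta)
  also have "\<dots> = (-1) ^ card {p \<in> A \<times> B. snd p \<le> fst p}"
    by (simp add: prod.If_cases Int_def cong: conj_cong)
  also have "{p \<in> A \<times> B. snd p \<le> fst p} = ?T \<union> ?S"
    by (auto simp: order_le_less)
  also have "card (?T \<union> ?S) = card ?T + card ?S"
    by (rule card_Un_disjoint) auto
  also have "card ?T = card (A \<inter> B)"
    by (rule card_image) (auto simp: inj_on_def)
  finally show ?thesis by (simp add: csigma_def)
qed

lemma prod_sym_diff_sign:
  fixes g :: "'a::finite \<Rightarrow> real"
  assumes "\<And>a. g a * g a = 1"
  shows "prod g (sym_diff A B) = prod g A * prod g B"
proof -
  have "prod g A = prod g (A - B) * prod g (A \<inter> B)" for A B :: "'a set"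
    by (subst prod.union_disjoint[symmetric]) (auto intro!: prod.cong)
  from this[of A B] this[of B A]
  have "prod g A * prod g B = prod g (A - B) * prod g (B - A) * prod (\<lambda>a. g a * g a) (A \<inter> B)"
    by (simp add: prod.distrib Int_commute)
  also have "prod g (A - B) * prod g (B - A) = prod g (sym_diff A B)"
    by (rule prod.union_disjoint[symmetric]) auto
  finally show ?thesis by (simp add: assms)
qed

lemma sign_sigma_sym_diff_left:
  fixes A B C :: "'a::{finite,linorder} set"
  shows "(-1::real) ^ csigma (sym_diff A B) C = (-1) ^ csigma A C * (-1) ^ csigma B C"
  unfolding sign_sigma by (rule prod_sym_diff_sign) (auto simp flip: prod.distrib intro!: prod.neutral)

lemma sign_sigma_sym_diff_right:
  fixes A B C :: "'a::{finite,linorder} set"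
  shows "(-1::real) ^ csigma A (sym_diff B C) = (-1) ^ csigma A B * (-1) ^ csigma A C"
  unfolding sign_sigma
  by (subst prod_sym_diff_sign) (auto simp: prod.distrib)

lemma sum_sym_diff_reindex:
  fixes g :: "'a::finite set \<Rightarrow> 'b::comm_monoid_add"
  shows "(\<Sum>A\<in>UNIV. g (sym_diff C A)) = (\<Sum>A\<in>UNIV. g A)"
  by (rule sum.reindex_bij_witness[of _ "sym_diff C" "sym_diff C"]) auto

text \<open>
  The product is the bilinear extension of \<open>I\<^sub>A I\<^sub>B = (-1)\<^bsup>\<sigma>(A,B)\<^esup> I\<^bsub>A\<triangle>B\<^esub>\<close>; the coefficient of
  \<open>I\<^sub>C\<close> collects the pairs with \<open>A \<triangle> B = C\<close>, that is \<open>B = A \<triangle> C\<close>.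
\<close>

instantiation clifford :: ("{finite,linorder}") real_algebra_1
begin
lift_definition one_clifford :: "'a clifford" is "axis {} 1" .
lift_definition times_clifford :: "'a clifford \<Rightarrow> 'a clifford \<Rightarrow> 'a clifford" is
  "\<lambda>x y. \<chi> C. \<Sum>A\<in>UNIV. (-1) ^ csigma A (sym_diff A C) * x $ A * y $ sym_diff A C" .
instance
proof
  fix x y z :: "'a clifford" and r :: real
  show "x * y * z = x * (y * z)"
  proof transfer
    fix x y z :: "real ^ 'a set"
    let ?s = "\<lambda>A B. (-1::real) ^ csigma A B"
    have sd: "sym_diff A (sym_diff B D) = sym_diff (sym_diff A B) D" for A B D :: "'a set"
      by blast
    have "(\<Sum>B\<in>UNIV. ?s B (sym_diff B D) *
             (\<Sum>A\<in>UNIV. ?s A (sym_diff A B) * x $ A * y $ sym_diff A B) * z $ sym_diff B D)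
        = (\<Sum>A\<in>UNIV. ?s A (sym_diff A D) * x $ A *
             (\<Sum>B\<in>UNIV. ?s B (sym_diff B (sym_diff A D)) * y $ B * z $ sym_diff B (sym_diff A D)))"
      (is "?l = ?r") for D
    proof -
      let ?t = "\<lambda>A B. ?s B (sym_diff B D) * ?s A (sym_diff A B) *
                 x $ A * y $ sym_diff A B * z $ sym_diff B D"
      have "?l = (\<Sum>B\<in>UNIV. \<Sum>A\<in>UNIV. ?t A B)"
        by (simp add: sum_distrib_left sum_distrib_right mult_ac)
      also have "\<dots> = (\<Sum>A\<in>UNIV. \<Sum>B\<in>UNIV. ?t A B)"
        by (rule sum.swap)
      also have "\<dots> = (\<Sum>A\<in>UNIV. \<Sum>B\<in>UNIV. ?t A (sym_diff A B))"
        by (intro sum.cong refl sum_sym_diff_reindex[symmetric])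
      also have "\<dots> = ?r"
      proof -
        have e1: "sym_diff A (sym_diff A B) = B" for A B :: "'a set" by blast
        have e2: "sym_diff (sym_diff A B) D = sym_diff B (sym_diff A D)" for A B :: "'a set" by blast
        have sg: "?s (sym_diff A B) (sym_diff B (sym_diff A D)) * ?s A B
                = ?s A (sym_diff A D) * ?s B (sym_diff B (sym_diff A D))" for A B
        proof -
          have sq: "(p * q) * r * p = q * r" if "p * p = 1" for p q r :: real
            using that by algebra
          have "?s (sym_diff A B) (sym_diff B (sym_diff A D)) * ?s A B =
            (?s A B * ?s A (sym_diff A D)) * ?s B (sym_diff B (sym_diff A D)) * ?s A B"
            by (simp only: sign_sigma_sym_diff_left sign_sigma_sym_diff_right[of A B])
          moreover have "?s A B * ?s A B = 1" by (simp flip: power_mult_distrib)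
          ultimately show ?thesis by (simp only: sq)
        qed
        have "?t A (sym_diff A B) = ?s A (sym_diff A D) * x $ A *
             (?s B (sym_diff B (sym_diff A D)) * y $ B * z $ sym_diff B (sym_diff A D))" for A B
          unfolding e1 e2 sg by (simp only: mult_ac)
        then show ?thesis by (simp only: sum_distrib_left)
      qed
      finally show ?thesis .
    qed
    then show "(\<chi> C. \<Sum>A\<in>UNIV. ?s A (sym_diff A C) *
          (\<chi> C. \<Sum>A\<in>UNIV. ?s A (sym_diff A C) * x $ A * y $ sym_diff A C) $ A * z $ sym_diff A C)
      = (\<chi> C. \<Sum>A\<in>UNIV. ?s A (sym_diff A C) * x $ A *
          (\<chi> C. \<Sum>A\<in>UNIV. ?s A (sym_diff A C) * y $ A * z $ sym_diff A C) $ sym_diff A C)"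
      by (simp only: vec_eq_iff vec_lambda_beta) simp
  qed
  show "1 * x = x"
  proof transfer
    fix x :: "real ^ 'a set"
    have "(\<Sum>A\<in>UNIV. (-1) ^ csigma A (sym_diff A C) * axis {} 1 $ A * x $ sym_diff A C) = x $ C" for C
      by (subst sum.mono_neutral_right[of _ "{{}}"]) (auto simp: axis_def csigma_def)
    then show "(\<chi> C. \<Sum>A\<in>UNIV. (-1) ^ csigma A (sym_diff A C) * axis {} 1 $ A * x $ sym_diff A C) = x"
      by (simp add: vec_eq_iff)
  qed
  show "x * 1 = x"
  proof transfer
    fix x :: "real ^ 'a set"
    have "(\<Sum>A\<in>UNIV. (-1) ^ csigma A (sym_diff A C) * x $ A * axis {} 1 $ sym_diff A C) = x $ C" for C
      by (subst sum.mono_neutral_right[of _ "{C}"]) (auto simp: axis_def csigma_def)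
    then show "(\<chi> C. \<Sum>A\<in>UNIV. (-1) ^ csigma A (sym_diff A C) * x $ A * axis {} 1 $ sym_diff A C) = x"
      by (simp add: vec_eq_iff)
  qed
  show "(x + y) * z = x * z + y * z"
    by transfer (simp add: vec_eq_iff algebra_simps sum.distrib)
  show "x * (y + z) = x * y + x * z"
    by transfer (simp add: vec_eq_iff algebra_simps sum.distrib)
  show "(r *\<^sub>R x) * y = r *\<^sub>R (x * y)"
    by transfer (simp add: vec_eq_iff sum_distrib_left mult_ac)
  show "x * (r *\<^sub>R y) = r *\<^sub>R (x * y)"
    by transfer (simp add: vec_eq_iff sum_distrib_left mult_ac)
  show "(0 :: 'a clifford) \<noteq> 1"
    by transfer (simp add: axis_eq_0_iff eq_commute[of 0])
qed
end

lift_definition gen :: "'n::{finite,linorder} \<Rightarrow> 'n clifford" is "\<lambda>i. axis {i} 1" .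

definition blade :: "'n::{finite,linorder} set \<Rightarrow> 'n clifford" where
  "blade A = prod_list (map gen (sorted_list_of_set A))"

text \<open>
  The next three facts identify the type with the algebra on the generators \<open>gen i\<close>: they satisfy the
  defining relations, and their ordered products form a basis.
\<close>

lemma coeffs_axis_mult:
  "Clifford (axis A 1) * Clifford (axis B 1) = (-1) ^ csigma A B *\<^sub>R Clifford (axis (sym_diff A B) 1)"
proof -
  have "(\<Sum>D\<in>UNIV. (-1) ^ csigma D (sym_diff D C) * axis A (1::real) $ D * axis B 1 $ sym_diff D C)
      = (-1) ^ csigma A B * axis (sym_diff A B) 1 $ C" for C
  proof -
    have "(\<Sum>D\<in>UNIV. (-1) ^ csigma D (sym_diff D C) * axis A (1::real) $ D * axis B 1 $ sym_diff D C)
        = (-1) ^ csigma A (sym_diff A C) * axis B 1 $ sym_diff A C"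
      by (subst sum.mono_neutral_right[of _ "{A}"]) (auto simp: axis_def)
    moreover have "sym_diff A C = B \<longleftrightarrow> C = sym_diff A B" by blast
    ultimately show ?thesis by (auto simp: axis_def)
  qed
  then show ?thesis
    by (simp add: times_clifford.abs_eq scaleR_clifford.abs_eq Clifford_inject vec_eq_iff)
qed

lemma gen_anticommute:
  fixes i j :: "'n::{finite,linorder}"
  shows "gen i * gen j + gen j * gen i = (if i = j then - 2 else 0)"
proof (cases "i = j")
  case True
  have e: "{(a, b). a = j \<and> b = j \<and> b < a} = {}" by auto
  have "gen j * gen j = - 1"
    unfolding gen_def one_clifford_def
    by (simp add: coeffs_axis_mult csigma_def e)
  then show ?thesis using True by simp
next
  case False
  have s: "{(a, b). a = i \<and> b = j \<and> b < a} = (if j < i then {(i, j)} else {})" for i j :: 'n by auto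
  have "sym_diff {j} {i} = sym_diff {i} {j}" by blast
  then show ?thesis using False
    unfolding gen_def
    by (cases i j rule: linorder_cases) (simp_all add: coeffs_axis_mult csigma_def s)
qed

lemma blade_eq:
  fixes A :: "'n::{finite,linorder} set"
  shows "blade A = Clifford (axis A 1)"
proof -
  have "prod_list (map gen xs) = Clifford (axis (set xs) 1)" if "sorted_wrt (<) xs" for xs :: "'n list"
    using that
  proof (induction xs)
    case Nil
    then show ?case by (simp add: one_clifford_def)
  next
    case (Cons a xs)
    have a: "a \<notin> set xs" and e: "{(u, v). u = a \<and> v \<in> set xs \<and> v < u} = {}"
      using Cons.prems by force+
    show ?case using Cons
      by (simp add: gen_def coeffs_axis_mult csigma_def a e)
  qed
  from this[of "sorted_list_of_set A"] show ?thesis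
    by (simp add: blade_def)
qed

lemma coeff_sum_blade: "ccoeff (\<Sum>A\<in>UNIV. c A *\<^sub>R blade A) B = c B"
proof -
  have add: "ccoeff (\<Sum>A\<in>S. g A) B = (\<Sum>A\<in>S. ccoeff (g A) B)" if "finite S"
    for S and g :: "'a set \<Rightarrow> 'a clifford"
    using that by (induction S) (simp_all add: zero_clifford.rep_eq plus_clifford.rep_eq)
  have "ccoeff (c A *\<^sub>R blade A) B = (if A = B then c B else 0)" for A
    by (auto simp: scaleR_clifford.rep_eq blade_eq Clifford_inverse axis_def)
  then show ?thesis by (simp add: add)
qed

section \<open>Slice monogenic functions\<close>

text \<open>
  Points of \<open>\<real>\<^bsup>n+1\<^esup>\<close> are pairs \<open>(x\<^sub>0, (x\<^sub>1, \<dots>, x\<^sub>n))\<close>, and the point \<open>u + Iv\<close> of \<open>\<complex>\<^sub>I\<close> is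
  \<open>(u, v I)\<close>. It is represented by the complex number \<open>u + iv\<close>; in particular subsets of
  \<open>\<complex>\<^sub>I\<close> and \<open>\<complex>\<^sub>I\<close>-valued functions on them become complex ones.
\<close>

definition vect :: "real ^ 'n::{finite,linorder} \<Rightarrow> 'n clifford" where
  "vect w = (\<Sum>i\<in>UNIV. (w $ i) *\<^sub>R gen i)"

definition unit_vects :: "(real ^ 'n) set" where
  "unit_vects = {w. norm w = 1}"

type_synonym 'n point = "real \<times> (real ^ 'n)"

definition slice_pt :: "real ^ 'n \<Rightarrow> complex \<Rightarrow> 'n point" where
  "slice_pt I z = (Re z, Im z *\<^sub>R I)"

definition slice_emb :: "real ^ 'n::{finite,linorder} \<Rightarrow> complex \<Rightarrow> 'n clifford" where
  "slice_emb I z = Re z *\<^sub>R 1 + Im z *\<^sub>R vect I"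

definition slice_of :: "'n::finite point set \<Rightarrow> (real, 'n) vec \<Rightarrow> complex set" where
  "slice_of U I = {z. slice_pt I z \<in> U}"

definition axially_symmetric :: "'n::finite point set \<Rightarrow> bool" where
  "axially_symmetric U \<longleftrightarrow>
     (\<forall>u v. \<forall>I\<in>unit_vects. (u, v *\<^sub>R I) \<in> U \<longrightarrow> (\<forall>J\<in>unit_vects. (u, v *\<^sub>R J) \<in> U))"

definition slice_domain :: "'n::finite point set \<Rightarrow> bool" where
  "slice_domain U \<longleftrightarrow> open U \<and> connected U \<and> (\<exists>u. (u, 0) \<in> U) \<and>
     (\<forall>I\<in>unit_vects. open (slice_of U I) \<and> connected (slice_of U I))"

definition slice_monogenic ::
    "'n::{finite,linorder} point set \<Rightarrow> ('n point \<Rightarrow> 'n clifford) \<Rightarrow> bool" where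
  "slice_monogenic U f \<longleftrightarrow> f differentiable_on U \<and>
     (\<forall>I\<in>unit_vects. \<forall>u v. (u, v *\<^sub>R I) \<in> U \<longrightarrow>
        (1/2) *\<^sub>R (vector_derivative (\<lambda>t. f (t, v *\<^sub>R I)) (at u)
               + vect I * vector_derivative (\<lambda>t. f (u, t *\<^sub>R I)) (at v)) = 0)"

section \<open>Splitting on the slice of the first generator and the slice product\<close>

text \<open>
  \<open>first\<close> is the index 1, so \<open>index_sets\<close> consists of the subsets of \<open>{2, \<dots>, n}\<close>; since
  \<open>I\<^sub>1 I\<^sub>A = I\<^bsub>{1}\<union>A\<^esub>\<close>, the blades over \<open>index_sets\<close> form a basis of the algebra as a left vector
  space over \<open>\<complex>\<^bsub>I1\<^esub>\<close>.
\<close>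

definition first :: "'n::{finite,linorder}" where
  "first = Min UNIV"

definition I1 :: "real ^ 'n::{finite,linorder}" where
  "I1 = axis first 1"

definition index_sets :: "'n::{finite,linorder} set set" where
  "index_sets = {A. first \<notin> A}"

definition splitting ::
    "'n::{finite,linorder} point set \<Rightarrow> ('n point \<Rightarrow> 'n clifford)
      \<Rightarrow> ('n set \<Rightarrow> complex \<Rightarrow> complex) \<Rightarrow> bool" where
  "splitting U f F \<longleftrightarrow>
     (\<forall>A\<in>index_sets. F A holomorphic_on slice_of U I1) \<and>
     (\<forall>z\<in>slice_of U I1. f (slice_pt I1 z) = (\<Sum>A\<in>index_sets. slice_emb I1 (F A z) * blade A))"

definition hat :: "(complex \<Rightarrow> complex) \<Rightarrow> complex \<Rightarrow> complex" where
  "hat F z = cnj (F (cnj z))"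

definition hat_if_odd :: "'n set \<Rightarrow> (complex \<Rightarrow> complex) \<Rightarrow> complex \<Rightarrow> complex" where
  "hat_if_odd A F = (if even (card A) then F else hat F)"

definition prod_component ::
    "('n::{finite,linorder} set \<Rightarrow> complex \<Rightarrow> complex) \<Rightarrow> ('n set \<Rightarrow> complex \<Rightarrow> complex)
      \<Rightarrow> 'n set \<Rightarrow> complex \<Rightarrow> complex" where
  "prod_component F H C z =
     (\<Sum>(A, B) | A \<in> index_sets \<and> B \<in> index_sets \<and> sym_diff A B = C.
        (-1) ^ csigma A B * F A z * hat_if_odd A (H B) z)"

text \<open>
  The value \<open>0\<close> outside \<open>U\<close> only serves to make the total HOL function unique.
\<close>

definition slice_product ::
    "'n::{finite,linorder} point set \<Rightarrow> ('n point \<Rightarrow> 'n clifford)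
      \<Rightarrow> ('n point \<Rightarrow> 'n clifford) \<Rightarrow> 'n point \<Rightarrow> 'n clifford" where
  "slice_product U f h = (THE g. slice_monogenic U g \<and> (\<forall>x. x \<notin> U \<longrightarrow> g x = 0) \<and>
     (\<exists>F H. splitting U f F \<and> splitting U h H \<and>
        (\<forall>z\<in>slice_of U I1. g (slice_pt I1 z) =
           (\<Sum>C\<in>index_sets. slice_emb I1 (prod_component F H C z) * blade C))))"

text \<open>
  \<open>index_sets\<close> as a type, so that its elements can index rows and columns of matrices.
\<close>

typedef (overloaded) 'n index = "index_sets :: 'n::{finite,linorder} set set"
  morphisms set_of_index Index
  by (auto simp: index_sets_def)

instance index :: ("{finite,linorder}") finite
proof
  show "finite (UNIV :: 'a index set)"
    by (metis finite finite_imageI type_definition.Abs_image[OF type_definition_index])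
qed

lemma CARD_index: "CARD('n::{finite,linorder} index) = 2 ^ (CARD('n) - 1)"
proof -
  have "CARD('n index) = card (index_sets :: 'n set set)"
    by (rule type_definition.card[OF type_definition_index])
  also have "index_sets = Pow (UNIV - {first :: 'n})" by (auto simp: index_sets_def)
  finally show ?thesis by (simp add: card_Pow card_Diff_singleton)
qed

definition slice_matrix ::
    "('n::{finite,linorder} set \<Rightarrow> complex \<Rightarrow> complex) \<Rightarrow> complex \<Rightarrow> complex ^ 'n index ^ 'n index" where
  "slice_matrix F z = (\<chi> a b. let A = set_of_index a; B = set_of_index b in
     (-1) ^ csigma (sym_diff A B) B * hat_if_odd A (F (sym_diff A B)) z)"

end

theory Submission
  imports Defs "HOL-Complex_Analysis.Conformal_Mappings"
begin

text \<open>
  By bilinearity of the sign exponent modulo 2, the matrix product \<open>M\<^sub>f M\<^sub>h\<close> is the matrix built from the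
  components \<open>K\<^sub>C\<close> of \<open>f\<^sub>I * h\<^sub>I\<close>; it is the identity on the (conjugation invariant) slice iff
  \<open>K\<^sub>\<emptyset> = 1\<close> and all other \<open>K\<^sub>C\<close> vanish, that is iff \<open>f\<^sub>I * h\<^sub>I = 1\<close>. This passes between the slice
  and \<open>U\<close> by the existence of the slice monogenic extension (representation formula) and its
  uniqueness. For uniqueness, each real coefficient of a slice monogenic function on \<open>\<complex>\<^sub>J\<close> is the
  real part of a holomorphic function, so vanishing on the real axis propagates to every slice.
\<close>

section \<open>Multiplication and the slice embeddings\<close>

lemma bounded_bilinear_clifford_mult:
  "bounded_bilinear ((*) :: 'n::{finite,linorder} clifford \<Rightarrow> 'n clifford \<Rightarrow> 'n clifford)"
  by (rule iffD1[OF bilinear_conv_bounded_bilinear bilinear_times])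

lemma linear_ccoeff: "linear (\<lambda>x :: 'n::{finite,linorder} clifford. ccoeff x A)"
  by (rule linearI) (simp_all add: plus_clifford.rep_eq scaleR_clifford.rep_eq)

lemma clifford_eqI:
  fixes x y :: "'n::{finite,linorder} clifford"
  assumes "\<And>A. ccoeff x A = ccoeff y A"
  shows "x = y"
  using assms by (metis coeffs_inject vec_eq_iff)

lemma linear_vect: "linear (vect :: real ^ 'n::{finite,linorder} \<Rightarrow> 'n clifford)"
  by (rule linearI) (simp_all add: vect_def scaleR_add_left sum.distrib scaleR_sum_right)

text \<open>Doubling the square symmetrises the double sum over the generators, so the
  anticommutation relations kill every off-diagonal term and leave \<open>-2\<close> times the
  squared coordinates.\<close>

lemma vect_mult_self:
  fixes w :: "real ^ 'n::{finite,linorder}"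
  shows "vect w * vect w = - ((norm w)\<^sup>2 *\<^sub>R 1)"
proof -
  let ?t = "\<lambda>i j. (w $ i * w $ j) *\<^sub>R (gen i * gen j)"
  have e: "vect w * vect w = (\<Sum>i\<in>UNIV. \<Sum>j\<in>UNIV. ?t i j)"
    by (simp add: vect_def sum_product mult.commute)
  also have "\<dots> = (\<Sum>i\<in>UNIV. \<Sum>j\<in>UNIV. ?t j i)"
    by (rule sum.swap)
  finally have e': "vect w * vect w = (\<Sum>i\<in>UNIV. \<Sum>j\<in>UNIV. ?t j i)" .
  have "2 *\<^sub>R (vect w * vect w) = (\<Sum>i\<in>UNIV. \<Sum>j\<in>UNIV. ?t i j + ?t j i)"
    by (simp add: scaleR_2 sum.distrib flip: e e')
  also have "\<dots> = (\<Sum>i\<in>UNIV. \<Sum>j\<in>UNIV. if i = j then (w $ i * w $ i) *\<^sub>R (-2) else 0)"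
  proof (intro sum.cong refl)
    fix i j :: 'n
    have "?t i j + ?t j i = (w $ i * w $ j) *\<^sub>R (gen i * gen j + gen j * gen i)"
      by (simp add: scaleR_add_right mult.commute)
    then show "?t i j + ?t j i = (if i = j then (w $ i * w $ i) *\<^sub>R (-2) else 0)"
      by (simp add: gen_anticommute)
  qed
  also have "\<dots> = (\<Sum>i\<in>UNIV. w $ i * w $ i) *\<^sub>R (-2)"
    by (simp only: scaleR_sum_left sum.delta finite_UNIV finite UNIV_I if_True sum.delta')
  also have "(\<Sum>i\<in>UNIV. w $ i * w $ i) = (norm w)\<^sup>2"
    by (simp add: power2_norm_eq_inner inner_vec_def)
  also have "(norm w)\<^sup>2 *\<^sub>R (-2 :: 'n clifford) = 2 *\<^sub>R (- ((norm w)\<^sup>2 *\<^sub>R 1))"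
  proof -
    have e: "(-2 :: 'n clifford) = 2 *\<^sub>R (-1)" by (simp add: scaleR_2)
    show ?thesis unfolding e by simp
  qed
  finally show ?thesis by (rule scaleR_left_imp_eq[rotated]) simp
qed

lemma unit_vect_mult_self:
  assumes "J \<in> unit_vects"
  shows "vect J * (vect J * x) = - x"
  using assms by (simp add: unit_vects_def vect_mult_self flip: mult.assoc)

lemma linear_slice_emb: "linear (slice_emb J)"
  by (rule linearI) (simp_all add: slice_emb_def algebra_simps)

lemma slice_emb_mult:
  assumes "J \<in> unit_vects"
  shows "slice_emb J (a * b) = slice_emb J a * slice_emb J b"
  using assms
  by (simp add: slice_emb_def algebra_simps unit_vects_def vect_mult_self)

text \<open>The difference is \<open>-2 * Im z\<close> times \<open>vect J\<close>, which squares to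
  -1. This produces the term proportional to the norm when the extension is differentiated at a real
  point.\<close>

lemma vect_slice_emb_diff_cnj:
  assumes "J \<in> unit_vects"
  shows "vect J * (slice_emb J (cnj z) - slice_emb J z) = (2 * Im z) *\<^sub>R 1"
  using assms
  by (simp add: slice_emb_def algebra_simps unit_vects_def vect_mult_self flip: scaleR_add_left)

section \<open>The coefficients of a splitting\<close>

lemma vect_I1: "vect I1 = (gen first :: 'n::{finite,linorder} clifford)"
proof -
  have "I1 $ i *\<^sub>R gen i = (if i = first then gen i else 0)" for i :: 'n
    by (simp add: I1_def axis_def)
  then show ?thesis by (simp add: vect_def)
qed

lemma I1_unit: "I1 \<in> unit_vects"
  by (simp add: I1_def unit_vects_def)

text \<open>Since \<open>first\<close> is the least index and lies outside \<open>A\<close>,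
  multiplying \<open>blade A\<close> by it on the left creates no inversion and no sign: the
  imaginary part lands exactly on \<open>insert first A\<close>.\<close>

lemma ccoeff_slice_emb_blade:
  fixes A B :: "'n::{finite,linorder} set"
  assumes "A \<in> index_sets"
  shows "ccoeff (slice_emb I1 z * blade A) B =
    (if B = A then Re z else if B = insert first A then Im z else 0)"
proof -
  have A: "first \<notin> A" using assms by (simp add: index_sets_def)
  have "\<not> x < first" for x :: 'n by (metis Min_le UNIV_I finite first_def not_less)
  then have "csigma {first} A = 0"
    using A by (auto simp: csigma_def)
  moreover have "sym_diff {first} A = insert first A" using A by auto
  moreover have "gen first = Clifford (axis {first :: 'n} 1)" by (simp add: gen_def)
  ultimately have "gen first * blade A = blade (insert first A)"
    by (simp add: blade_eq coeffs_axis_mult)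
  then have "slice_emb I1 z * blade A = Re z *\<^sub>R blade A + Im z *\<^sub>R blade (insert first A)"
    by (simp add: slice_emb_def vect_I1 distrib_right)
  moreover have "A \<noteq> insert first A" using A by auto
  ultimately show ?thesis
    by (auto simp: plus_clifford.rep_eq scaleR_clifford.rep_eq blade_eq Clifford_inverse axis_def)
qed

text \<open>The sets \<open>A\<close> and \<open>insert first A\<close>, for \<open>A\<close> in
  \<open>index_sets\<close>, are pairwise distinct, so no two terms of the sum overlap. This gives
  the linear independence of the blades over the slice field.\<close>

lemma ccoeff_sum_slice_emb_blade:
  fixes B :: "'n::{finite,linorder} set"
  assumes "B \<in> index_sets"
  shows "ccoeff (\<Sum>A\<in>index_sets. slice_emb I1 (c A) * blade A) B = Re (c B)"
    and "ccoeff (\<Sum>A\<in>index_sets. slice_emb I1 (c A) * blade A) (insert first B) = Im (c B)"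
proof -
  have B: "first \<notin> B" using assms by (simp add: index_sets_def)
  have s: "ccoeff (\<Sum>A\<in>index_sets. slice_emb I1 (c A) * blade A) D =
     (\<Sum>A\<in>index_sets. if D = A then Re (c A) else if D = insert first A then Im (c A) else 0)"
    for D :: "'n set"
    by (subst linear_sum[OF linear_ccoeff]) (simp add: ccoeff_slice_emb_blade)
  show "ccoeff (\<Sum>A\<in>index_sets. slice_emb I1 (c A) * blade A) B = Re (c B)"
    unfolding s using assms B
    by (subst sum.mono_neutral_right[of _ "{B}"]) auto
  have "insert first B \<noteq> B" using B by auto
  moreover have "A \<noteq> insert first B" "insert first B = insert first A \<longleftrightarrow> B = A"
    if "A \<in> index_sets" for A
    using that B by (auto simp: index_sets_def insert_ident)
  ultimately show "ccoeff (\<Sum>A\<in>index_sets. slice_emb I1 (c A) * blade A) (insert first B) = Im (c B)"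
    unfolding s using assms
    by (subst sum.mono_neutral_right[of _ "{B}"]) auto
qed

lemma sum_slice_emb_blade_eq_iff:
  "(\<Sum>A\<in>index_sets. slice_emb I1 (c A) * blade A) = (\<Sum>A\<in>index_sets. slice_emb I1 (d A) * blade A)
    \<longleftrightarrow> (\<forall>A\<in>index_sets. c A = d A)"
  (is "?l c = ?l d \<longleftrightarrow> _")
proof
  assume e: "?l c = ?l d"
  show "\<forall>A\<in>index_sets. c A = d A"
  proof (intro ballI complex_eqI)
    fix A :: "'a set" assume A: "A \<in> index_sets"
    show "Re (c A) = Re (d A)" "Im (c A) = Im (d A)"
      using ccoeff_sum_slice_emb_blade[OF A, of c] ccoeff_sum_slice_emb_blade[OF A, of d]
      by (simp_all add: e)
  qed
qed simp

lemma sum_slice_emb_blade_eq_1_iff: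
  "(\<Sum>A\<in>index_sets. slice_emb I1 (c A) * blade A) = 1
    \<longleftrightarrow> (\<forall>A\<in>index_sets. c A = (if A = {} then 1 else 0))"
proof -
  have "(1 :: 'a clifford) = (\<Sum>A\<in>index_sets. slice_emb I1 (if A = {} then 1 else 0) * blade A)"
    by (subst sum.mono_neutral_right[of _ "{{}}"])
      (auto simp: index_sets_def slice_emb_def blade_def)
  then show ?thesis by (subst \<open>1 = _\<close>) (rule sum_slice_emb_blade_eq_iff)
qed

text \<open>Makes the components independent of the choice of splitting, which the existential in
  \<open>slice_product\<close> needs.\<close>

lemma splitting_unique:
  assumes "splitting U f F" "splitting U f G" "A \<in> index_sets" "z \<in> slice_of U I1"
  shows "F A z = G A z"
  using assms sum_slice_emb_blade_eq_iff[of "\<lambda>A. F A z" "\<lambda>A. G A z"]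
  by (simp add: splitting_def)

section \<open>The matrix of a slice product\<close>

text \<open>For fixed \<open>C\<close> the first index determines the second, so the sum over pairs
  collapses to a single sum.\<close>

lemma prod_component_eq:
  assumes "C \<in> index_sets"
  shows "prod_component F H C z =
    (\<Sum>E\<in>index_sets. (-1) ^ csigma E (sym_diff E C) * F E z * hat_if_odd E (H (sym_diff E C)) z)"
  unfolding prod_component_def
proof (rule sum.reindex_bij_witness[of _ "\<lambda>E. (E, sym_diff E C)" fst])
  have e: "sym_diff A (sym_diff A B) = B" for A B :: "'a set" by auto
  fix p assume "p \<in> {(A, B). A \<in> index_sets \<and> B \<in> index_sets \<and> sym_diff A B = C}"
  then show "(-1) ^ csigma (fst p) (sym_diff (fst p) C) * F (fst p) z
      * hat_if_odd (fst p) (H (sym_diff (fst p) C)) z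
      = (case p of (A, B) \<Rightarrow> (-1) ^ csigma A B * F A z * hat_if_odd A (H B) z)"
    by (auto simp only: e mem_Collect_eq case_prod_conv fst_conv split: prod.splits)
qed (use assms in \<open>auto simp: index_sets_def\<close>)

section \<open>Parity, conjugation and sign rules behind the matrix product\<close>

lemma even_card_sym_diff:
  fixes A B :: "'a::finite set"
  shows "even (card (sym_diff A B)) \<longleftrightarrow> (even (card A) \<longleftrightarrow> even (card B))"
proof -
  have "card X = card (X - Y) + card (X \<inter> Y)" for X Y :: "'a set"
    by (metis add.commute card_Int_Diff finite)
  from this[of A B] this[of B A]
  have "card A + card B = card (A - B) + card (B - A) + 2 * card (A \<inter> B)"
    by (simp add: Int_commute)
  also have "card (A - B) + card (B - A) = card (sym_diff A B)"
    by (rule card_Un_disjoint[symmetric]) auto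
  finally show ?thesis by presburger
qed

text \<open>\<open>hat\<close> is an involution and cardinality is additive modulo 2 under symmetric
  difference, so the conjugations compose like parities.\<close>

lemma hat_if_odd_sym_diff:
  fixes A E :: "'a::finite set"
  shows "hat_if_odd (sym_diff A E) F = hat_if_odd A (hat_if_odd E F)"
  by (auto simp: hat_if_odd_def even_card_sym_diff hat_def fun_eq_iff)

lemma hat_if_odd_sign_sum:
  "hat_if_odd A (\<lambda>z. \<Sum>E\<in>S. (-1) ^ p E * F E z * G E z) z =
    (\<Sum>E\<in>S. (-1) ^ p E * hat_if_odd A (F E) z * hat_if_odd A (G E) z)"
  by (simp add: hat_if_odd_def hat_def)

lemma complex_sign_sigma_sym_diff:
  fixes A B C :: "'a::{finite,linorder} set"
  shows "(-1::complex) ^ csigma (sym_diff A B) C = (-1) ^ csigma A C * (-1) ^ csigma B C"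
    and "(-1::complex) ^ csigma A (sym_diff B C) = (-1) ^ csigma A B * (-1) ^ csigma A C"
  using arg_cong[OF sign_sigma_sym_diff_left[of A B C], of complex_of_real]
    arg_cong[OF sign_sigma_sym_diff_right[of A B C], of complex_of_real] by simp_all

lemma sum_index: "(\<Sum>a\<in>UNIV. g (set_of_index a)) = (\<Sum>A\<in>index_sets. g A)"
  by (rule sum.reindex_bij_witness[of _ Index set_of_index])
     (auto simp: set_of_index_inverse Index_inverse set_of_index)

text \<open>The matrices behave like a regular representation of the slice product: row
  \<open>A\<close> and column \<open>B\<close> give the component at \<open>C\<close>, the symmetric
  difference of \<open>A\<close> and \<open>B\<close>, with the sign and conjugation prescribed by
  \<open>slice_matrix\<close>.\<close>

lemma slice_matrix_mult:
  fixes F H :: "'n::{finite,linorder} set \<Rightarrow> complex \<Rightarrow> complex"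
  shows "slice_matrix F z ** slice_matrix H z = slice_matrix (prod_component F H) z"
proof -
  have "(slice_matrix F z ** slice_matrix H z) $ a $ b = slice_matrix (prod_component F H) z $ a $ b"
    for a b :: "'n index"
  proof -
    let ?s = "\<lambda>A B. (-1::complex) ^ csigma A B"
    define A where "A = set_of_index a"
    define B where "B = set_of_index b"
    have AB: "A \<in> index_sets" "B \<in> index_sets"
      unfolding A_def B_def by (rule set_of_index)+
    define C where "C = sym_diff A B"
    have C: "C \<in> index_sets" using AB by (auto simp: C_def index_sets_def)
    have "(slice_matrix F z ** slice_matrix H z) $ a $ b =
        (\<Sum>D\<in>index_sets. ?s (sym_diff A D) D * hat_if_odd A (F (sym_diff A D)) z *
          (?s (sym_diff D B) B * hat_if_odd D (H (sym_diff D B)) z))"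
      by (simp add: matrix_matrix_mult_def slice_matrix_def Let_def A_def B_def
          flip: sum_index)
    \<comment> \<open>Substitute \<open>E = sym_diff A D\<close> for the summation index; then
      \<open>sym_diff D B\<close> becomes \<open>sym_diff E C\<close>.\<close>
    also have "\<dots> = (\<Sum>E\<in>index_sets. ?s C B * (?s E (sym_diff E C) * hat_if_odd A (F E) z *
          hat_if_odd A (hat_if_odd E (H (sym_diff E C))) z))"
    proof (rule sum.reindex_bij_witness[of _ "sym_diff A" "sym_diff A"])
      fix D
      show "sym_diff A (sym_diff A D) = D" "sym_diff A (sym_diff A D) = D" by auto
      show "sym_diff A D \<in> index_sets" if "D \<in> index_sets"
        using that AB by (auto simp: index_sets_def)
      show "sym_diff A D \<in> index_sets" if "D \<in> index_sets"
        using that AB by (auto simp: index_sets_def)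
      let ?E = "sym_diff A D"
      have D: "D = sym_diff A ?E" by auto
      have DB: "sym_diff D B = sym_diff ?E C" by (auto simp: C_def)
      have sq: "?s X Y * ?s X Y = 1" for X Y :: "'n set" by (simp flip: power_mult_distrib)
      \<comment> \<open>By bimultiplicativity both sides expand to the same four signs, those of the
        pairs \<open>(E, A)\<close>, \<open>(E, E)\<close>, \<open>(E, B)\<close> and
        \<open>(C, B)\<close>.\<close>
      have sg: "?s ?E D * ?s (sym_diff D B) B = ?s C B * ?s ?E (sym_diff ?E C)"
      proof -
        have "?s ?E D = ?s ?E A * ?s ?E ?E"
          by (subst D) (rule complex_sign_sigma_sym_diff)
        moreover have "?s (sym_diff D B) B = ?s ?E B * ?s C B"
          unfolding DB by (rule complex_sign_sigma_sym_diff)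
        moreover have "?s ?E (sym_diff ?E C) = ?s ?E ?E * (?s ?E A * ?s ?E B)"
          unfolding C_def by (simp only: complex_sign_sigma_sym_diff(2)[of ?E])
        ultimately show ?thesis by (simp only: mult_ac)
      qed
      have hd: "hat_if_odd D G = hat_if_odd A (hat_if_odd ?E G)" for G
        by (subst D) (rule hat_if_odd_sym_diff)
      have "c * (e * x * y) = p * x * (q * y)" if "p * q = c * e" for c e p q x y :: complex
        using that by algebra
      from this[OF sg] show "?s C B * (?s ?E (sym_diff ?E C) * hat_if_odd A (F ?E) z *
            hat_if_odd A (hat_if_odd ?E (H (sym_diff ?E C))) z) =
          ?s ?E D * hat_if_odd A (F ?E) z * (?s (sym_diff D B) B * hat_if_odd D (H (sym_diff D B)) z)"
        unfolding DB hd .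
    qed
    \<comment> \<open>\<open>hat\<close> is additive, multiplicative and fixes real signs, so the
      conjugation belonging to row \<open>A\<close> can be pulled out of the whole sum.\<close>
    also have "\<dots> = ?s C B * hat_if_odd A (prod_component F H C) z"
    proof -
      have "prod_component F H C = (\<lambda>z. \<Sum>E\<in>index_sets.
          ?s E (sym_diff E C) * F E z * hat_if_odd E (H (sym_diff E C)) z)"
        using C by (intro ext prod_component_eq)
      then show ?thesis by (simp only: hat_if_odd_sign_sum sum_distrib_left)
    qed
    finally show ?thesis
      by (simp add: slice_matrix_def Let_def A_def B_def C_def)
  qed
  then show ?thesis by (simp add: vec_eq_iff)
qed

lemma slice_matrix_eq_1_iff:
  fixes K :: "'n::{finite,linorder} set \<Rightarrow> complex \<Rightarrow> complex"
  assumes "\<And>z. z \<in> S \<Longrightarrow> cnj z \<in> S"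
  shows "(\<forall>z\<in>S. slice_matrix K z = mat 1) \<longleftrightarrow>
    (\<forall>z\<in>S. \<forall>C\<in>index_sets. K C z = (if C = {} then 1 else 0))" (is "?L \<longleftrightarrow> ?R")
proof
  assume L: ?L
  show ?R
  proof (intro ballI)
    fix z C assume z: "z \<in> S" and C: "C \<in> (index_sets :: 'n set set)"
    have e: "{} \<in> (index_sets :: 'n set set)" by (simp add: index_sets_def)
    \<comment> \<open>Row \<open>{}\<close> is even, hence free of conjugation: it lists all
      components up to sign, and the sign is 1 at \<open>C = {}\<close>.\<close>
    have "slice_matrix K z $ Index {} $ Index C = mat 1 $ Index {} $ Index C"
      using L z by simp
    then have "(-1) ^ csigma C C * K C z = (if C = {} then 1 else 0)"
      by (auto simp: slice_matrix_def mat_def Index_inverse e C hat_if_odd_def Index_inject)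
    then show "K C z = (if C = {} then 1 else 0)"
      by (cases "C = {}") (auto simp: csigma_def)
  qed
next
  assume R: ?R
  show ?L
  proof (intro ballI)
    fix z assume z: "z \<in> S"
    have "slice_matrix K z $ a $ b = mat 1 $ a $ b" for a b :: "'n index"
    proof -
      let ?A = "set_of_index a" and ?B = "set_of_index b"
      have "first \<notin> ?A" "first \<notin> ?B"
        using set_of_index[of a] set_of_index[of b] by (auto simp: index_sets_def)
      then have C: "sym_diff ?A ?B \<in> index_sets" by (auto simp: index_sets_def)
      \<comment> \<open>Odd rows evaluate \<open>K\<close> at \<open>cnj z\<close>, which stays in
        \<open>S\<close>; the prescribed values 0 and 1 are real and survive conjugation.\<close>
      have "hat_if_odd ?A (K (sym_diff ?A ?B)) z = (if sym_diff ?A ?B = {} then 1 else 0)"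
        using R z assms[OF z] C by (auto simp: hat_if_odd_def hat_def)
      moreover have "sym_diff ?A ?B = {} \<longleftrightarrow> a = b"
        using set_of_index_inject[of a b] by auto
      ultimately show ?thesis
        by (auto simp: slice_matrix_def Let_def mat_def csigma_def)
    qed
    then show "slice_matrix K z = mat 1" by (simp add: vec_eq_iff)
  qed
qed


section \<open>Derivatives along a slice\<close>

lemma slice_pt_has_derivative: "(slice_pt J has_derivative slice_pt J) (at z)"
  unfolding slice_pt_def by (auto intro!: derivative_eq_intros)

lemma slice_derivatives:
  assumes "((\<lambda>z. g (slice_pt J z)) has_derivative G) (at (Complex u v))"
  shows "vector_derivative (\<lambda>t. g (t, v *\<^sub>R J)) (at u) = G 1"
    and "vector_derivative (\<lambda>t. g (u, t *\<^sub>R J)) (at v) = G \<i>"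
proof -
  have lin: "linear G" using assms by (rule has_derivative_linear)
  have a: "((\<lambda>t. Complex t v) has_derivative (\<lambda>h. h *\<^sub>R 1)) (at u)"
    unfolding Complex_eq by (auto intro!: derivative_eq_intros simp: scaleR_conv_of_real)
  have "((\<lambda>t. g (slice_pt J (Complex t v))) has_derivative (\<lambda>h. G (h *\<^sub>R 1))) (at u)"
    using has_derivative_compose[OF a assms] .
  then show "vector_derivative (\<lambda>t. g (t, v *\<^sub>R J)) (at u) = G 1"
    by (intro vector_derivative_at)
       (simp add: has_vector_derivative_def slice_pt_def linear_scale[OF lin])
  have b: "((\<lambda>t. Complex u t) has_derivative (\<lambda>h. h *\<^sub>R \<i>)) (at v)"
    unfolding Complex_eq by (auto intro!: derivative_eq_intros simp: scaleR_conv_of_real)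
  have "((\<lambda>t. g (slice_pt J (Complex u t))) has_derivative (\<lambda>h. G (h *\<^sub>R \<i>))) (at v)"
    using has_derivative_compose[OF b assms] .
  then show "vector_derivative (\<lambda>t. g (u, t *\<^sub>R J)) (at v) = G \<i>"
    by (intro vector_derivative_at)
       (simp add: has_vector_derivative_def slice_pt_def linear_scale[OF lin])
qed

text \<open>Replaces the two partial derivatives by one Frechet derivative \<open>G\<close> along
  the slice, with \<open>G 1\<close> and \<open>G \<i>\<close> as the partials; this form can be
  added, composed and transferred directly.\<close>

lemma slice_monogenicI:
  fixes U :: "'n::{finite,linorder} point set"
  assumes "\<And>x. x \<in> U \<Longrightarrow> g differentiable (at x)"
    and "\<And>J z. J \<in> unit_vects \<Longrightarrow> z \<in> slice_of U J \<Longrightarrow>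
      \<exists>G. ((\<lambda>z. g (slice_pt J z)) has_derivative G) (at z) \<and> G 1 + vect J * G \<i> = 0"
  shows "slice_monogenic U g"
  unfolding slice_monogenic_def
proof (intro conjI ballI allI impI)
  show "g differentiable_on U"
    using assms(1) by (simp add: differentiable_at_imp_differentiable_on)
next
  fix J :: "(real, 'n) vec" and u v
  assume J: "J \<in> unit_vects" and "(u, v *\<^sub>R J) \<in> U"
  then have "Complex u v \<in> slice_of U J" by (simp add: slice_of_def slice_pt_def)
  from assms(2)[OF J this] obtain G
    where G: "((\<lambda>z. g (slice_pt J z)) has_derivative G) (at (Complex u v))"
      and "G 1 + vect J * G \<i> = 0" by blast
  then show "(1/2) *\<^sub>R (vector_derivative (\<lambda>t. g (t, v *\<^sub>R J)) (at u)
      + vect J * vector_derivative (\<lambda>t. g (u, t *\<^sub>R J)) (at v)) = 0"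
    by (simp only: slice_derivatives[OF G] scaleR_zero_right)
qed

lemma slice_monogenicD:
  fixes U :: "'n::{finite,linorder} point set"
  assumes "slice_monogenic U g" "open U" "J \<in> unit_vects" "z \<in> slice_of U J"
  obtains G where "((\<lambda>z. g (slice_pt J z)) has_derivative G) (at z)" "G 1 + vect J * G \<i> = 0"
proof -
  have x: "slice_pt J z \<in> U" using assms(4) by (simp add: slice_of_def)
  then have "g differentiable (at (slice_pt J z))"
    using assms(1,2) by (simp add: slice_monogenic_def differentiable_on_eq_differentiable_at)
  then obtain g' where "(g has_derivative g') (at (slice_pt J z))"
    by (auto simp: differentiable_def)
  from has_derivative_compose[OF slice_pt_has_derivative this]
  have G: "((\<lambda>z. g (slice_pt J z)) has_derivative (\<lambda>h. g' (slice_pt J h))) (at z)" .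
  then have G': "((\<lambda>z. g (slice_pt J z)) has_derivative (\<lambda>h. g' (slice_pt J h)))
      (at (Complex (Re z) (Im z)))" by simp
  have "(1/2) *\<^sub>R (vector_derivative (\<lambda>t. g (t, Im z *\<^sub>R J)) (at (Re z))
      + vect J * vector_derivative (\<lambda>t. g (Re z, t *\<^sub>R J)) (at (Im z))) = 0"
    using assms(1,3) x by (simp add: slice_monogenic_def slice_pt_def)
  then have "g' (slice_pt J 1) + vect J * g' (slice_pt J \<i>) = 0"
    by (simp only: slice_derivatives[OF G']) simp
  with G that show thesis by blast
qed

section \<open>The identity principle\<close>

lemma slice_ptE:
  fixes x :: "'n::{finite,linorder} point"
  obtains J z where "J \<in> unit_vects" "x = slice_pt J z"
proof (cases "snd x = 0")
  case True
  then have "x = slice_pt I1 (of_real (fst x))"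
    by (simp add: slice_pt_def prod_eq_iff)
  with I1_unit that show thesis by blast
next
  case False
  then have "sgn (snd x) \<in> unit_vects" by (simp add: unit_vects_def norm_sgn)
  moreover have "x = slice_pt (sgn (snd x)) (Complex (fst x) (norm (snd x)))"
    using False by (simp add: slice_pt_def prod_eq_iff sgn_div_norm)
  ultimately show thesis using that by blast
qed

lemma slice_of_of_real: "complex_of_real u \<in> slice_of U J \<longleftrightarrow> (u, 0) \<in> U"
  by (simp add: slice_of_def slice_pt_def)

text \<open>All slices share the real points of \<open>U\<close>, so the one-variable identity
  theorem on each single slice suffices.\<close>

lemma slice_monogenic_eq_0:
  fixes U :: "'n::{finite,linorder} point set"
  assumes U: "slice_domain U" and g: "slice_monogenic U g"
    and 0: "\<And>u. (u, 0) \<in> U \<Longrightarrow> g (u, 0) = 0" and "x \<in> U"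
  shows "g x = 0"
proof -
  obtain J w where J: "J \<in> unit_vects" and x: "x = slice_pt J w"
    by (rule slice_ptE)
  have w: "w \<in> slice_of U J" using \<open>x \<in> U\<close> by (simp add: slice_of_def x)
  have op: "open (slice_of U J)" and con: "connected (slice_of U J)" and "open U"
    using U J by (auto simp: slice_domain_def)
  obtain u where "(u, 0) \<in> U" using U by (auto simp: slice_domain_def)
  then have u: "complex_of_real u \<in> slice_of U J" by (simp add: slice_of_of_real)
  have "ccoeff (g x) A = ccoeff 0 A" for A
  proof -
    define l where "l = (\<lambda>y :: 'n clifford. ccoeff y A)"
    have l: "linear l" unfolding l_def by (rule linear_ccoeff)
    txt \<open>\<open>p\<close> is complex linear when \<open>\<i>\<close> acts as left multiplication by \<open>J\<close>, so it turns a slice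
      monogenic function into a holomorphic one on the slice of \<open>J\<close>.\<close>
    define p where "p = (\<lambda>y. Complex (l y) (- l (vect J * y)))"
    have p: "linear p"
      by (rule linearI)
         (simp_all add: p_def complex_eq_iff linear_add[OF l] linear_scale[OF l] distrib_left)
    have pJ: "p (vect J * y) = \<i> * p y" for y
      using J by (simp add: p_def complex_eq_iff unit_vect_mult_self linear_neg[OF l])
    have hol: "(\<lambda>z. p (g (slice_pt J z))) holomorphic_on slice_of U J"
      unfolding holomorphic_on_open[OF op]
    proof
      fix z assume "z \<in> slice_of U J"
      then obtain G where G: "((\<lambda>z. g (slice_pt J z)) has_derivative G) (at z)"
        and CR: "G 1 + vect J * G \<i> = 0"
        using slice_monogenicD[OF g \<open>open U\<close> J] by blast
      have lin: "linear G" using G by (rule has_derivative_linear)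
      \<comment> \<open>Multiplying the Cauchy-Riemann equation by \<open>vect J\<close> solves it
        for \<open>G \<i>\<close>; applying \<open>p\<close> then makes the derivative complex
        linear.\<close>
      have "vect J * (G 1 + vect J * G \<i>) = 0" by (simp add: CR)
      then have Gi: "G \<i> = vect J * G 1"
        using J by (simp add: distrib_left unit_vect_mult_self)
      have "p (G h) = p (G 1) * h" for h
      proof -
        have "h = Re h *\<^sub>R 1 + Im h *\<^sub>R \<i>" by (simp add: complex_eq_iff)
        from arg_cong[OF this, of G] have "G h = Re h *\<^sub>R G 1 + Im h *\<^sub>R G \<i>"
          by (simp only: linear_add[OF lin] linear_scale[OF lin])
        then have "p (G h) = Re h *\<^sub>R p (G 1) + Im h *\<^sub>R (\<i> * p (G 1))"
          by (simp add: Gi pJ linear_add[OF p] linear_scale[OF p])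
        then show ?thesis by (simp add: complex_eq_iff algebra_simps)
      qed
      then have pG: "(\<lambda>h. p (G h)) = (*) (p (G 1))" by (rule ext)
      have "((\<lambda>z. p (g (slice_pt J z))) has_derivative (\<lambda>h. p (G h))) (at z)"
        by (rule bounded_linear.has_derivative[OF iffD1[OF linear_conv_bounded_linear p] G])
      then show "\<exists>f'. ((\<lambda>z. p (g (slice_pt J z))) has_field_derivative f') (at z)"
        unfolding pG has_field_derivative_def by blast
    qed
    \<comment> \<open>The slice is open, so it contains a real interval around \<open>u\<close>;
      half the radius of a ball gives a second real point.\<close>
    have lim: "of_real u islimpt (slice_of U J \<inter> \<real>)"
    proof (rule islimptI)
      fix T assume T: "complex_of_real u \<in> T" "open T"
      then obtain e where e: "e > 0" "ball (complex_of_real u) e \<subseteq> T \<inter> slice_of U J"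
        using op u by (meson IntI openE open_Int)
      then have "complex_of_real (u + e / 2) \<in> T \<inter> slice_of U J"
        by (intro subsetD[OF e(2)]) (simp add: dist_norm)
      then show "\<exists>y\<in>slice_of U J \<inter> \<real>. y \<in> T \<and> y \<noteq> complex_of_real u"
        using e(1) by (intro bexI[of _ "complex_of_real (u + e / 2)"]) auto
    qed
    have zero: "p (g (slice_pt J z)) = 0" if "z \<in> slice_of U J \<inter> \<real>" for z
      using that 0 linear_0[OF p] by (auto simp: slice_of_def slice_pt_def elim!: Reals_cases)
    have "p (g (slice_pt J w)) = 0"
      by (rule analytic_continuation[OF hol op con Int_lower1 u lim zero w])
    then show ?thesis
      by (simp add: p_def x l_def zero_clifford.rep_eq complex_eq_iff)
  qed
  then show ?thesis by (rule clifford_eqI)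
qed

lemma slice_monogenic_diff:
  fixes U :: "'n::{finite,linorder} point set"
  assumes "open U" "slice_monogenic U f" "slice_monogenic U g"
  shows "slice_monogenic U (\<lambda>x. f x - g x)"
proof (rule slice_monogenicI)
  show "(\<lambda>x. f x - g x) differentiable (at x)" if "x \<in> U" for x
    using assms that
    by (auto simp: slice_monogenic_def differentiable_on_eq_differentiable_at
        intro!: differentiable_diff)
next
  fix J z assume Jz: "J \<in> unit_vects" "z \<in> slice_of U J"
  obtain F' where "((\<lambda>z. f (slice_pt J z)) has_derivative F') (at z)" "F' 1 + vect J * F' \<i> = 0"
    using slice_monogenicD[OF assms(2,1) Jz] .
  moreover obtain G' where "((\<lambda>z. g (slice_pt J z)) has_derivative G') (at z)"
      "G' 1 + vect J * G' \<i> = 0"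
    using slice_monogenicD[OF assms(3,1) Jz] .
  ultimately show "\<exists>G. ((\<lambda>z. f (slice_pt J z) - g (slice_pt J z)) has_derivative G) (at z)
      \<and> G 1 + vect J * G \<i> = 0"
    by (intro exI[of _ "\<lambda>h. F' h - G' h"] conjI has_derivative_diff)
       (simp_all add: algebra_simps add_eq_0_iff2)
qed

lemma slice_monogenic_eqI:
  fixes U :: "'n::{finite,linorder} point set"
  assumes "slice_domain U" "slice_monogenic U f" "slice_monogenic U g"
    and "\<And>z. z \<in> slice_of U J \<Longrightarrow> f (slice_pt J z) = g (slice_pt J z)" and "x \<in> U"
  shows "f x = g x"
proof -
  have "slice_monogenic U (\<lambda>x. f x - g x)"
    using assms by (intro slice_monogenic_diff) (auto simp: slice_domain_def)
  moreover have "f (u, 0) - g (u, 0) = 0" if "(u, 0) \<in> U" for u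
    using assms(4)[of "of_real u"] that by (simp add: slice_of_def slice_pt_def)
  ultimately have "f x - g x = 0"
    using slice_monogenic_eq_0[OF assms(1)] \<open>x \<in> U\<close> by blast
  then show ?thesis by simp
qed


section \<open>The slice monogenic extension\<close>

text \<open>
  The representation formula: a slice monogenic function is determined by its restriction \<open>k\<close> to the
  slice of \<open>I\<close>. At real points \<open>sgn 0 = 0\<close> is harmless because its cofactor vanishes there.
\<close>

definition slice_ext ::
    "(real, 'n::{finite,linorder}) vec \<Rightarrow> (complex \<Rightarrow> 'n clifford) \<Rightarrow> 'n point \<Rightarrow> 'n clifford" where
  "slice_ext I k p = (let z = Complex (fst p) (norm (snd p)) in
     (1/2) *\<^sub>R (k z + k (cnj z) + vect (sgn (snd p)) * (vect I * (k (cnj z) - k z))))"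

text \<open>The definition always uses the representative in the closed upper half plane. The
  formula is invariant under replacing \<open>(z, J)\<close> by \<open>(cnj z, -J)\<close>, so it
  holds for every \<open>z\<close>.\<close>

lemma slice_ext_slice_pt:
  assumes "J \<in> unit_vects"
  shows "slice_ext I k (slice_pt J z) =
    (1/2) *\<^sub>R (k z + k (cnj z) + vect J * (vect I * (k (cnj z) - k z)))"
proof -
  have J: "norm J = 1" "sgn J = J" using assms by (simp_all add: unit_vects_def sgn_div_norm)
  consider "Im z > 0" | "Im z < 0" | "Im z = 0" by linarith
  then show ?thesis
  proof cases
    case 1
    then have "Complex (Re z) (norm (Im z *\<^sub>R J)) = z" by (simp add: J complex_eq_iff)
    with 1 show ?thesis by (simp add: slice_ext_def slice_pt_def sgn_scaleR J)
  next
    case 2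
    then have z: "Complex (Re z) (norm (Im z *\<^sub>R J)) = cnj z" by (simp add: J complex_eq_iff)
    have "sgn (Im z *\<^sub>R J) = - J" using 2 by (simp add: sgn_scaleR J)
    then show ?thesis unfolding slice_ext_def slice_pt_def Let_def fst_conv snd_conv z
      by (simp add: linear_neg[OF linear_vect] right_diff_distrib add.commute)
  next
    case 3
    then have "cnj z = z" by (simp add: complex_eq_iff)
    moreover from this 3 have "Complex (Re z) (norm (Im z *\<^sub>R J)) = z"
      by (simp add: complex_eq_iff)
    ultimately show ?thesis by (simp add: slice_ext_def slice_pt_def)
  qed
qed

lemma slice_ext_same:
  assumes "I \<in> unit_vects"
  shows "slice_ext I k (slice_pt I z) = k z"
  using assms by (simp add: slice_ext_slice_pt unit_vect_mult_self flip: scaleR_2)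

section \<open>Differentiability of the extension, along slices and in all variables\<close>

lemmas clifford_mult_has_derivative =
  bounded_bilinear.FDERIV[OF bounded_bilinear_clifford_mult]

lemma clifford_const_mult_has_derivative:
  fixes c :: "'n::{finite,linorder} clifford"
  assumes "(f has_derivative f') F"
  shows "((\<lambda>x. c * f x) has_derivative (\<lambda>h. c * f' h)) F"
  by (rule bounded_linear.has_derivative
      [OF bounded_bilinear.bounded_linear_right[OF bounded_bilinear_clifford_mult] assms])

lemma clifford_mult_differentiable:
  fixes f g :: "'a::real_normed_vector \<Rightarrow> 'n::{finite,linorder} clifford"
  assumes "f differentiable (at x)" "g differentiable (at x)"
  shows "(\<lambda>x. f x * g x) differentiable (at x)"
  using assms unfolding differentiable_def by (blast intro: clifford_mult_has_derivative)

text \<open>The hypotheses say that the derivatives of \<open>k\<close> are left linear over the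
  slice field of \<open>I\<close>. Left multiplication by \<open>vect J\<close> then turns
  \<open>?G \<i>\<close> into \<open>- ?G 1\<close>, since \<open>vect I\<close> and
  \<open>vect J\<close> both square to -1.\<close>

lemma slice_ext_slice_CR:
  fixes k :: "complex \<Rightarrow> 'n::{finite,linorder} clifford"
  assumes I: "I \<in> unit_vects" and J: "J \<in> unit_vects"
    and k: "(k has_derivative (\<lambda>h. slice_emb I h * D)) (at z)"
    and k': "(k has_derivative (\<lambda>h. slice_emb I h * D')) (at (cnj z))"
  shows "\<exists>G. ((\<lambda>z. slice_ext I k (slice_pt J z)) has_derivative G) (at z) \<and> G 1 + vect J * G \<i> = 0"
proof -
  have c: "(cnj has_derivative cnj) (at z)"
    by (rule bounded_linear_imp_has_derivative[OF bounded_linear_cnj])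
  note kc = has_derivative_compose[OF c k']
  let ?G = "\<lambda>h. (1/2) *\<^sub>R (slice_emb I h * D + slice_emb I (cnj h) * D'
      + vect J * (vect I * (slice_emb I (cnj h) * D' - slice_emb I h * D)))"
  have "((\<lambda>z. slice_ext I k (slice_pt J z)) has_derivative ?G) (at z)"
    unfolding slice_ext_slice_pt[OF J]
    by (intro has_derivative_scaleR_right has_derivative_add has_derivative_diff
        clifford_const_mult_has_derivative k kc)
  moreover have "?G 1 + vect J * ?G \<i> = 0"
  proof -
    have "vect J * ?G \<i> = - ?G 1"
      using unit_vect_mult_self[OF I] unit_vect_mult_self[OF J]
      by (simp add: slice_emb_def algebra_simps)
    then show ?thesis by simp
  qed
  ultimately show ?thesis by blast
qed

lemma differentiable_bounded_linear_compose:
  assumes "bounded_linear L" "f differentiable F"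
  shows "(\<lambda>x. L (f x)) differentiable F"
  using assms unfolding differentiable_def by (blast intro: bounded_linear.has_derivative)

text \<open>Off the real axis \<open>norm\<close> and \<open>sgn\<close> are differentiable, so the
  chain and product rules apply.\<close>

lemma slice_ext_differentiable_nonreal:
  fixes k :: "complex \<Rightarrow> 'n::{finite,linorder} clifford"
  assumes p: "snd p \<noteq> 0"
    and k: "k differentiable (at (Complex (fst p) (norm (snd p))))"
    and k': "k differentiable (at (cnj (Complex (fst p) (norm (snd p)))))"
  shows "slice_ext I k differentiable (at p)"
proof -
  let ?z = "\<lambda>p :: 'n point. Complex (fst p) (norm (snd p))"
  have n: "(\<lambda>p :: 'n point. norm (snd p)) differentiable (at p)"
    using differentiable_chain_at[of snd p norm] p
    by (simp add: o_def differentiable_norm_at bounded_linear_imp_differentiable bounded_linear_snd)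
  note fst = bounded_linear_imp_differentiable[OF bounded_linear_fst]
    and snd = bounded_linear_imp_differentiable[OF bounded_linear_snd]
  have z: "?z differentiable (at p)"
    unfolding Complex_eq
    by (rule differentiable_add[OF differentiable_bounded_linear_compose[OF bounded_linear_of_real fst]
        differentiable_mult[OF differentiable_const
          differentiable_bounded_linear_compose[OF bounded_linear_of_real n]]])
  have zc: "(\<lambda>p. cnj (?z p)) differentiable (at p)"
    by (rule differentiable_bounded_linear_compose[OF bounded_linear_cnj z])
  have "(\<lambda>p :: 'n point. sgn (snd p)) differentiable (at p)"
    unfolding sgn_div_norm
    by (rule differentiable_scaleR[OF differentiable_inverse[OF n] snd]) (use p in simp)
  then have s: "(\<lambda>p :: 'n point. vect (sgn (snd p))) differentiable (at p)"
    by (rule differentiable_bounded_linear_compose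
        [OF iffD1[OF linear_conv_bounded_linear linear_vect]])
  have kz: "(\<lambda>p. k (?z p)) differentiable (at p)"
    using differentiable_chain_at[OF z k] by (simp add: o_def)
  have kzc: "(\<lambda>p. k (cnj (?z p))) differentiable (at p)"
    using differentiable_chain_at[OF zc k'] by (simp add: o_def)
  have e: "slice_ext I k = (\<lambda>p. (1/2) *\<^sub>R (k (?z p) + k (cnj (?z p)) +
      vect (sgn (snd p)) * (vect I * (k (cnj (?z p)) - k (?z p)))))"
    by (simp add: slice_ext_def fun_eq_iff Let_def)
  show ?thesis unfolding e
    by (intro differentiable_scaleR differentiable_add differentiable_diff differentiable_const
        clifford_mult_differentiable s kz kzc)
qed

text \<open>At a real point \<open>norm\<close> and \<open>sgn\<close> are singular, so the
  derivative is guessed and checked: it is the derivative of \<open>k\<close> with the slice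
  increment replaced by the full paravector increment, as in \<open>?L\<close>.\<close>

lemma slice_ext_differentiable_real:
  fixes k :: "complex \<Rightarrow> 'n::{finite,linorder} clifford"
  assumes I: "I \<in> unit_vects"
    and k: "(k has_derivative (\<lambda>h. slice_emb I h * D)) (at (complex_of_real u))"
  shows "slice_ext I k differentiable (at (u, 0))"
proof -
  let ?L = "\<lambda>p :: 'n point. (fst p *\<^sub>R 1 + vect (snd p)) * D"
  have lin: "linear ?L"
    by (rule linearI) (simp_all add: linear_add[OF linear_vect] linear_scale[OF linear_vect] algebra_simps)
  define c where "c = k (of_real u)"
  \<comment> \<open>The first-order remainder of \<open>k\<close> at \<open>u\<close>. By
    \<open>key\<close> below, the remainder of the extension is the representation formula applied
    to \<open>R\<close>.\<close>
  define R where "R = (\<lambda>z. k z - c - slice_emb I (z - of_real u) * D)"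
  have R: "\<exists>d>0. \<forall>z. norm (z - of_real u) < d \<longrightarrow> norm (R z) \<le> e * norm (z - of_real u)" if "e > 0" for e
    using k that unfolding has_derivative_at_alt R_def c_def by blast
  have key: "slice_ext I k (a, w) - slice_ext I k (u, 0) - ?L ((a, w) - (u, 0)) =
      (1/2) *\<^sub>R (R (Complex a (norm w)) + R (cnj (Complex a (norm w)))
        + vect (sgn w) * (vect I * (R (cnj (Complex a (norm w))) - R (Complex a (norm w)))))" for a w
  proof -
    let ?z = "Complex a (norm w)"
    have kz: "k z = R z + c + slice_emb I (z - of_real u) * D" for z
      by (simp add: R_def)
    have "vect I * (slice_emb I (cnj ?z - of_real u) * D - slice_emb I (?z - of_real u) * D)
        = (2 * norm w) *\<^sub>R D"
      using vect_slice_emb_diff_cnj[OF I, of "?z - of_real u"]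
      by (simp flip: left_diff_distrib mult.assoc)
    then have d1: "vect I * (k (cnj ?z) - k ?z) = vect I * (R (cnj ?z) - R ?z) + (2 * norm w) *\<^sub>R D"
      unfolding kz by (simp add: algebra_simps)
    \<comment> \<open>Here the singularity disappears: \<open>sgn w\<close> scaled by
      \<open>norm w\<close> is \<open>w\<close>, which is linear.\<close>
    have d2: "vect (sgn w) * ((2 * norm w) *\<^sub>R D) = 2 *\<^sub>R (vect w * D)"
      by (cases "w = 0") (simp_all add: sgn_div_norm linear_scale[OF linear_vect] linear_0[OF linear_vect])
    have "slice_emb I (?z - of_real u) * D + slice_emb I (cnj ?z - of_real u) * D
        = (2 * (a - u)) *\<^sub>R D"
      by (simp add: slice_emb_def algebra_simps flip: scaleR_add_left)
    then have d3: "k ?z + k (cnj ?z) = R ?z + R (cnj ?z) + 2 *\<^sub>R c + (2 * (a - u)) *\<^sub>R D"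
      unfolding kz by (simp add: algebra_simps scaleR_2)
    have d4: "slice_ext I k (u, 0) = c"
      using slice_ext_same[OF I, of k "of_real u"] by (simp add: slice_pt_def c_def)
    have "slice_ext I k (a, w) = (1/2) *\<^sub>R (R ?z + R (cnj ?z) + 2 *\<^sub>R c + (2 * (a - u)) *\<^sub>R D
        + (vect (sgn w) * (vect I * (R (cnj ?z) - R ?z)) + 2 *\<^sub>R (vect w * D)))"
      by (simp only: slice_ext_def Let_def fst_conv snd_conv d1 d2 d3 distrib_left)
    then show ?thesis
      unfolding d4 by (simp add: algebra_simps)
  qed
  obtain B where B: "B > 0" "\<And>x y :: 'n clifford. norm (x * y) \<le> norm x * norm y * B"
    using bounded_bilinear.pos_bounded[OF bounded_bilinear_clifford_mult] by blast
  obtain V where V: "V > 0" "\<And>w :: (real, 'n) vec. norm (vect w) \<le> norm w * V"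
    using bounded_linear.pos_bounded[OF iffD1[OF linear_conv_bounded_linear linear_vect]] by blast
  have vm: "norm (vect w * x) \<le> V * B * norm x" if "norm w \<le> 1" for w :: "(real, 'n) vec" and x
  proof -
    have "norm (vect w) \<le> V" using V(2)[of w] V(1) that
      by (metis mult_right_mono mult_1 less_imp_le order_trans)
    then have "norm (vect w) * norm x * B \<le> V * norm x * B"
      using B(1) by (intro mult_right_mono) auto
    then show ?thesis using B(2)[of "vect w" x] by (simp add: mult_ac)
  qed
  \<comment> \<open>Half of \<open>2 * c\<close>, from the sum, plus half of
    \<open>(V * B)\<^sup>2 * (2 * c)\<close>, from two multiplications by vectors of norm at most
    1.\<close>
  define M where "M = 1 + (V * B)\<^sup>2"
  have M: "M > 0" unfolding M_def by (simp add: add_pos_nonneg)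
  have bound: "norm ((1/2) *\<^sub>R (x + y + vect (sgn w) * (vect I * (y - x)))) \<le> M * c"
    if "norm x \<le> c" "norm y \<le> c" for x y :: "'n clifford" and w c
  proof -
    have "norm (vect (sgn w) * (vect I * (y - x))) \<le> V * B * norm (vect I * (y - x))"
      by (rule vm) (simp add: norm_sgn)
    also have "\<dots> \<le> V * B * (V * B * norm (y - x))"
      using I V(1) B(1) by (intro mult_left_mono vm) (auto simp: unit_vects_def)
    also have "\<dots> = (V * B)\<^sup>2 * norm (y - x)" by (simp add: power2_eq_square)
    also have "\<dots> \<le> (V * B)\<^sup>2 * (2 * c)"
      using norm_triangle_ineq4[of y x] that by (intro mult_left_mono) auto
    finally have "norm (vect (sgn w) * (vect I * (y - x))) \<le> (V * B)\<^sup>2 * (2 * c)" .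
    moreover have "norm (x + y) \<le> 2 * c" using norm_triangle_ineq[of x y] that by linarith
    ultimately have "norm (x + y + vect (sgn w) * (vect I * (y - x))) \<le> 2 * c + (V * B)\<^sup>2 * (2 * c)"
      by (rule norm_triangle_le[OF add_mono, rotated -1])
    moreover have "1/2 * N \<le> (1 + q) * c" if "N \<le> 2 * c + q * (2 * c)" for N q :: real
      using that by (simp add: algebra_simps)
    ultimately show ?thesis by (simp add: M_def)
  qed
  have "(slice_ext I k has_derivative ?L) (at (u, 0))"
    unfolding has_derivative_at_alt
  proof (intro conjI allI impI)
    show "bounded_linear ?L" using lin by (rule iffD1[OF linear_conv_bounded_linear])
    fix e :: real assume "e > 0"
    then have "e / M > 0" using M by simp
    from R[OF this] obtain d where d: "d > 0"
      "\<And>z. norm (z - of_real u) < d \<Longrightarrow> norm (R z) \<le> e / M * norm (z - of_real u)" by blast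
    have "norm (slice_ext I k y - slice_ext I k (u, 0) - ?L (y - (u, 0))) \<le> e * norm (y - (u, 0))"
      if y: "norm (y - (u, 0)) < d" for y
    proof -
      obtain a w where aw: "y = (a, w)" by (cases y)
      let ?z = "Complex a (norm w)"
      \<comment> \<open>Both evaluation points of \<open>k\<close> are as far from \<open>u\<close>
        as \<open>y\<close> is from \<open>(u, 0)\<close>, so one \<open>d\<close> serves all
        three.\<close>
      have n: "norm (?z - of_real u) = norm (y - (u, 0))"
        "norm (cnj ?z - of_real u) = norm (y - (u, 0))"
        by (simp_all add: aw norm_Pair cmod_def)
      have "norm (R ?z) \<le> e / M * norm (y - (u, 0))" "norm (R (cnj ?z)) \<le> e / M * norm (y - (u, 0))"
        using d(2)[of ?z] d(2)[of "cnj ?z"] y unfolding n by blast+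
      from bound[OF this, of w] show ?thesis
        using M unfolding aw key by simp
    qed
    then show "\<exists>d>0. \<forall>y. norm (y - (u, 0)) < d \<longrightarrow>
        norm (slice_ext I k y - slice_ext I k (u, 0) - ?L (y - (u, 0))) \<le> e * norm (y - (u, 0))"
      using d(1) by blast
  qed
  then show ?thesis by (rule differentiableI)
qed

lemma slice_monogenic_cong:
  fixes U :: "'n::{finite,linorder} point set"
  assumes "open U" "slice_monogenic U f" "\<And>x. x \<in> U \<Longrightarrow> g x = f x"
    and "\<And>J. J \<in> unit_vects \<Longrightarrow> open (slice_of U J)"
  shows "slice_monogenic U g"
proof (rule slice_monogenicI)
  fix x assume x: "x \<in> U"
  then have "f differentiable (at x)"
    using assms(1,2) by (simp add: slice_monogenic_def differentiable_on_eq_differentiable_at)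
  then obtain f' where "(f has_derivative f') (at x)" by (auto simp: differentiable_def)
  then have "(g has_derivative f') (at x)"
    by (rule has_derivative_transform_within_open[OF _ assms(1) x]) (simp add: assms(3))
  then show "g differentiable (at x)" by (rule differentiableI)
next
  fix J z assume Jz: "J \<in> unit_vects" "z \<in> slice_of U J"
  obtain G where G: "((\<lambda>z. f (slice_pt J z)) has_derivative G) (at z)" "G 1 + vect J * G \<i> = 0"
    using slice_monogenicD[OF assms(2,1) Jz] .
  have "((\<lambda>z. g (slice_pt J z)) has_derivative G) (at z)"
    by (rule has_derivative_transform_within_open[OF G(1) assms(4)[OF Jz(1)] Jz(2)])
       (simp add: assms(3) slice_of_def)
  then show "\<exists>G. ((\<lambda>z. g (slice_pt J z)) has_derivative G) (at z) \<and> G 1 + vect J * G \<i> = 0"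
    using G(2) by blast
qed

section \<open>Symmetry of the slices and the extension to the whole domain\<close>

lemma slice_of_eq:
  assumes "axially_symmetric U" "I \<in> unit_vects" "J \<in> unit_vects"
  shows "slice_of U I = slice_of U J"
  using assms unfolding axially_symmetric_def slice_of_def slice_pt_def by blast

text \<open>Conjugation on the slice of \<open>I\<close> amounts to passing to the direction
  \<open>-I\<close>.\<close>

lemma cnj_mem_slice_of:
  assumes "axially_symmetric U" "I \<in> unit_vects" "z \<in> slice_of U I"
  shows "cnj z \<in> slice_of U I"
proof -
  have "- I \<in> unit_vects" using assms(2) by (simp add: unit_vects_def)
  then have "z \<in> slice_of U (- I)" using slice_of_eq assms by blast
  then show ?thesis by (simp add: slice_of_def slice_pt_def)
qed

lemma slice_monogenic_slice_ext:
  fixes U :: "'n::{finite,linorder} point set"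
  assumes U: "open U" "axially_symmetric U" and I: "I \<in> unit_vects"
    and k: "\<And>z. z \<in> slice_of U I \<Longrightarrow> \<exists>D. (k has_derivative (\<lambda>h. slice_emb I h * D)) (at z)"
  shows "slice_monogenic U (slice_ext I k)"
proof (rule slice_monogenicI)
  fix x assume x: "x \<in> U"
  show "slice_ext I k differentiable (at x)"
  proof (cases "snd x = 0")
    case True
    then have e: "x = (fst x, 0)" by (simp add: prod_eq_iff)
    then have "of_real (fst x) \<in> slice_of U I" using x by (simp add: slice_of_of_real)
    from k[OF this] obtain D where "(k has_derivative (\<lambda>h. slice_emb I h * D)) (at (of_real (fst x)))"
      by blast
    then show ?thesis by (subst e) (rule slice_ext_differentiable_real[OF I])
  next
    case False
    define z where "z = Complex (fst x) (norm (snd x))"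
    have "sgn (snd x) \<in> unit_vects" using False by (simp add: unit_vects_def norm_sgn)
    moreover have "z \<in> slice_of U (sgn (snd x))"
      using x False by (simp add: slice_of_def slice_pt_def sgn_div_norm z_def)
    ultimately have "z \<in> slice_of U I" using slice_of_eq[OF U(2) I] by blast
    with cnj_mem_slice_of[OF U(2) I] k have "k differentiable (at z)" "k differentiable (at (cnj z))"
      by (blast intro: differentiableI)+
    then show ?thesis using False unfolding z_def by (intro slice_ext_differentiable_nonreal)
  qed
next
  fix J z assume J: "J \<in> unit_vects" and "z \<in> slice_of U J"
  then have z: "z \<in> slice_of U I" using slice_of_eq[OF U(2) I J] by simp
  obtain D D' where "(k has_derivative (\<lambda>h. slice_emb I h * D)) (at z)"
    "(k has_derivative (\<lambda>h. slice_emb I h * D')) (at (cnj z))"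
    using k[OF z] k[OF cnj_mem_slice_of[OF U(2) I z]] by blast
  then show "\<exists>G. ((\<lambda>z. slice_ext I k (slice_pt J z)) has_derivative G) (at z) \<and> G 1 + vect J * G \<i> = 0"
    by (rule slice_ext_slice_CR[OF I J])
qed

section \<open>The slice product\<close>

text \<open>\<open>slice_emb I\<close> is multiplicative on the commutative field of complex
  numbers, so the increment can be moved to the far left of each term and factored out.\<close>

lemma slice_emb_sum_has_derivative:
  assumes I: "I \<in> unit_vects"
    and K: "\<And>C. C \<in> S \<Longrightarrow> K C holomorphic_on W" and "open W" "z \<in> W"
  shows "\<exists>D. ((\<lambda>z. \<Sum>C\<in>S. slice_emb I (K C z) * b C) has_derivative (\<lambda>h. slice_emb I h * D)) (at z)"
proof -
  have "((\<lambda>z. slice_emb I (K C z) * b C) has_derivative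
      (\<lambda>h. slice_emb I h * (slice_emb I (deriv (K C) z) * b C))) (at z)" if "C \<in> S" for C
  proof -
    have "linear (\<lambda>x. slice_emb I x * b C)"
      by (rule linearI)
         (simp_all add: linear_add[OF linear_slice_emb] linear_scale[OF linear_slice_emb] distrib_right)
    then have bl: "bounded_linear (\<lambda>x. slice_emb I x * b C)"
      by (rule iffD1[OF linear_conv_bounded_linear])
    have "(K C has_derivative (*) (deriv (K C) z)) (at z)"
      using holomorphic_derivI[OF K[OF that] assms(3,4)] by (simp add: has_field_derivative_def)
    from bounded_linear.has_derivative[OF bl this] show ?thesis
      by (simp add: slice_emb_mult[OF I] mult.commute[of "deriv (K C) z"] mult.assoc)
  qed
  then have "((\<lambda>z. \<Sum>C\<in>S. slice_emb I (K C z) * b C) has_derivative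
      (\<lambda>h. \<Sum>C\<in>S. slice_emb I h * (slice_emb I (deriv (K C) z) * b C))) (at z)"
    by (rule has_derivative_sum)
  then show ?thesis by (auto simp flip: sum_distrib_left)
qed

section \<open>Holomorphy of the components and well-definedness of the slice product\<close>

lemma hat_holomorphic:
  assumes "F holomorphic_on W" "open W" "\<And>z. z \<in> W \<Longrightarrow> cnj z \<in> W"
  shows "hat F holomorphic_on W"
proof -
  have "cnj ` W = W" using assms(3) by (metis image_subsetI complex_cnj_cnj imageI subset_antisym subsetI)
  then have "(cnj \<circ> F \<circ> cnj) holomorphic_on W"
    using assms(1,2) holomorphic_on_compose_cnj_cnj[of F W] by simp
  then show ?thesis by (simp add: hat_def[abs_def] o_def)
qed

lemma prod_component_holomorphic:
  fixes F H :: "'n::{finite,linorder} set \<Rightarrow> complex \<Rightarrow> complex"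
  assumes "\<And>A. A \<in> index_sets \<Longrightarrow> F A holomorphic_on W"
    and "\<And>A. A \<in> index_sets \<Longrightarrow> H A holomorphic_on W"
    and "open W" "\<And>z. z \<in> W \<Longrightarrow> cnj z \<in> W"
  shows "prod_component F H C holomorphic_on W"
  unfolding prod_component_def[abs_def] case_prod_beta hat_if_odd_def
  using assms by (intro holomorphic_on_sum holomorphic_on_mult holomorphic_on_const) (auto intro: hat_holomorphic)

lemma prod_component_cong:
  fixes F F' H H' :: "'n::{finite,linorder} set \<Rightarrow> complex \<Rightarrow> complex"
  assumes "\<And>A w. A \<in> index_sets \<Longrightarrow> w \<in> {z, cnj z} \<Longrightarrow> F A w = F' A w"
    and "\<And>A w. A \<in> index_sets \<Longrightarrow> w \<in> {z, cnj z} \<Longrightarrow> H A w = H' A w"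
  shows "prod_component F H C z = prod_component F' H' C z"
  unfolding prod_component_def using assms
  by (intro sum.cong refl) (auto simp: hat_if_odd_def hat_def)

text \<open>Shows that the definite description in \<open>slice_product\<close> has exactly one
  solution, and that its values on the slice may be computed from any given splittings.\<close>

lemma slice_product:
  fixes U :: "'n::{finite,linorder} point set"
  assumes U: "slice_domain U" "axially_symmetric U"
    and F: "splitting U f F" and H: "splitting U h H"
  shows slice_monogenic_slice_product: "slice_monogenic U (slice_product U f h)"
    and slice_product_slice_pt: "z \<in> slice_of U I1 \<Longrightarrow> slice_product U f h (slice_pt I1 z) =
      (\<Sum>C\<in>index_sets. slice_emb I1 (prod_component F H C z) * blade C)"
proof -
  let ?W = "slice_of U (I1 :: (real, 'n) vec)"
  let ?k = "\<lambda>z. \<Sum>C\<in>index_sets. slice_emb I1 (prod_component F H C z) * blade C"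
  let ?P = "\<lambda>g. slice_monogenic U g \<and> (\<forall>x. x \<notin> U \<longrightarrow> g x = 0) \<and>
     (\<exists>F H. splitting U f F \<and> splitting U h H \<and>
        (\<forall>z\<in>?W. g (slice_pt I1 z) =
           (\<Sum>C\<in>index_sets. slice_emb I1 (prod_component F H C z) * blade C)))"
  have op: "open U" "open ?W" and opJ: "\<And>J. J \<in> unit_vects \<Longrightarrow> open (slice_of U J)"
    using U(1) I1_unit by (auto simp: slice_domain_def)
  have cW: "cnj z \<in> ?W" if "z \<in> ?W" for z
    using cnj_mem_slice_of[OF U(2) I1_unit that] .
  \<comment> \<open>A candidate may come with other splittings; they agree with \<open>F\<close> and
    \<open>H\<close> at \<open>z\<close> and at \<open>cnj z\<close>, the only points entering the
    product at \<open>z\<close>.\<close>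
  have slice: "g (slice_pt I1 z) = ?k z" if g: "?P g" and z: "z \<in> ?W" for g z
  proof -
    obtain F' H' where "splitting U f F'" "splitting U h H'"
      and gz: "g (slice_pt I1 z) =
        (\<Sum>C\<in>index_sets. slice_emb I1 (prod_component F' H' C z) * blade C)"
      using g z by blast
    then have "prod_component F' H' C z = prod_component F H C z" for C
      using splitting_unique[OF _ F] splitting_unique[OF _ H] z cW[OF z]
      by (intro prod_component_cong) blast+
    then show ?thesis by (simp add: gz)
  qed
  \<comment> \<open>The existence witness: the representation formula, cut off outside
    \<open>U\<close> to match the normalisation in the definition.\<close>
  define g where "g = (\<lambda>x. if x \<in> U then slice_ext I1 ?k x else 0)"
  have "prod_component F H C holomorphic_on ?W" for C
    using F H op(2) cW by (intro prod_component_holomorphic) (auto simp: splitting_def)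
  then have "slice_monogenic U (slice_ext I1 ?k)"
    by (intro slice_monogenic_slice_ext op(1) U(2) I1_unit slice_emb_sum_has_derivative[OF I1_unit _ op(2)])
  then have "slice_monogenic U g"
    by (rule slice_monogenic_cong[OF op(1) _ _ opJ]) (simp add: g_def)
  moreover have "\<forall>z\<in>?W. g (slice_pt I1 z) = ?k z"
    by (simp add: g_def slice_of_def slice_ext_same[OF I1_unit])
  ultimately have "?P g" using F H by (auto simp: g_def)
  moreover have "g1 = g" if "?P g1" for g1
  proof
    fix x
    show "g1 x = g x"
    proof (cases "x \<in> U")
      case True
      then show ?thesis
        using slice_monogenic_eqI[OF U(1), of g1 g I1 x] slice[OF that] slice[OF \<open>?P g\<close>]
          that \<open>?P g\<close> by metis
    next
      case False
      then have "g1 x = 0" using that by blast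
      then show ?thesis using False by (simp add: g_def)
    qed
  qed
  ultimately have P: "?P (slice_product U f h)"
    unfolding slice_product_def by (rule theI)
  then show "slice_monogenic U (slice_product U f h)" by blast
  show "slice_product U f h (slice_pt I1 z) = ?k z" if "z \<in> ?W"
    using slice[OF P that] .
qed

theorem proposition4p1:
  fixes U :: "'n::{finite,linorder} point set"
    and f h :: "'n point \<Rightarrow> 'n clifford"
    and F H :: "'n set \<Rightarrow> complex \<Rightarrow> complex"
  assumes "CARD('n) \<ge> 2"
    and "slice_domain U" and "axially_symmetric U"
    and "slice_monogenic U f" and "slice_monogenic U h"
    and "splitting U f F" and "splitting U h H"
  shows "(\<forall>x\<in>U. slice_product U f h x = 1) \<longleftrightarrow>
    (\<forall>z\<in>slice_of U I1. slice_matrix F z ** slice_matrix H z = mat 1)"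
proof -
  let ?W = "slice_of U (I1 :: (real, 'n) vec)"
  note prod = slice_product[OF assms(2,3,6,7)]
  have one: "slice_monogenic U (\<lambda>_. 1)"
    by (rule slice_monogenicI) (auto intro!: exI[of _ "\<lambda>_. 0"])
  \<comment> \<open>The constant 1 is slice monogenic, so the identity principle lifts equality from
    the slice of \<open>I1\<close> to \<open>U\<close>.\<close>
  have "(\<forall>x\<in>U. slice_product U f h x = 1) \<longleftrightarrow>
      (\<forall>z\<in>?W. slice_product U f h (slice_pt I1 z) = 1)"
    using slice_monogenic_eqI[OF assms(2) prod(1) one, of I1] by (auto simp: slice_of_def)
  also have "\<dots> \<longleftrightarrow> (\<forall>z\<in>?W. \<forall>C\<in>index_sets. prod_component F H C z = (if C = {} then 1 else 0))"
    by (intro ball_cong refl) (simp only: prod(2) sum_slice_emb_blade_eq_1_iff)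
  also have "\<dots> \<longleftrightarrow> (\<forall>z\<in>?W. slice_matrix (prod_component F H) z = mat 1)"
    by (rule slice_matrix_eq_1_iff[symmetric]) (rule cnj_mem_slice_of[OF assms(3) I1_unit])
  finally show ?thesis by (simp only: slice_matrix_mult)
qed

end
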